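(* There is an absolute constant $C$ such that for every positive integer $r$ and every $m$ for which a $\overline{\mathrm{DD}}^*(m,r)$ exists, \[ m\leq \tfrac{\sqrt{3}}{2}\, r + 3^{4/3}2^{-5/3}\,r^{2/3}+C\,r^{1/3}. \]
   Context: The hexagonal grid is the set of centres of a tiling of the plane by regular hexagons in which centres of hexagons sharing an edge are at Euclidean distance $1$; two centres are adjacent iff their hexagons share an edge. We represent it by $\mathbb{Z}^2$, identifying $(i,j)\in\mathbb{Z}^2$ with the plane point $i(1,0)+j(-\tfrac12,\tfrac{\sqrt3}{2})$; then the neighbours of $(i,j)$ are $(i\pm1,j)$, $(i,j\pm1)$, $(i+1,j+1)$, $(i-1,j-1)$. The hexagonal distance between two points is the graph distance in this adjacency graph (equal to $\max(|\Delta i|,|\Delta j|,|\Delta i-\Delta j|)$). A $\overline{\mathrm{DD}}^*(m,r)$ (hexagonal distinct difference configuration) is a set of $m$ points ("dots") of the hexagonal grid such that (1) any two dots are at hexagonal distance at most $r$, and (2) the lines joining pairs of dots are pairwise distinct either in length or in slope; equivalently, the vectors $a-b$, over ordered pairs $(a,b)$ of distinct dots, are pairwise distinct. *)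

theory Defs
  imports "HOL-Analysis.Analysis"
begin

definition hex_point :: "int \<times> int \<Rightarrow> real \<times> real" where
  "hex_point p = (real_of_int (fst p) - real_of_int (snd p) / 2, sqrt 3 / 2 * real_of_int (snd p))"

definition hex_adj :: "((int \<times> int) \<times> (int \<times> int)) set" where
  "hex_adj = {((i, j), q) | i j q.
     q \<in> {(i + 1, j), (i - 1, j), (i, j + 1), (i, j - 1), (i + 1, j + 1), (i - 1, j - 1)}}"

definition hex_dist :: "int \<times> int \<Rightarrow> int \<times> int \<Rightarrow> nat" where
  "hex_dist p q = (LEAST n. (p, q) \<in> hex_adj ^^ n)"

text \<open>The value \<open>None\<close> is the slope of a vertical line.\<close>

definition line_slope :: "real \<times> real \<Rightarrow> real \<times> real \<Rightarrow> real option" where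
  "line_slope x y =
     (if fst x = fst y then None else Some ((snd y - snd x) / (fst y - fst x)))"

definition distinct_lines :: "(int \<times> int) set \<Rightarrow> bool" where
  "distinct_lines A \<longleftrightarrow>
     (\<forall>a\<in>A. \<forall>b\<in>A. \<forall>c\<in>A. \<forall>d\<in>A. a \<noteq> b \<longrightarrow> c \<noteq> d \<longrightarrow> {a, b} \<noteq> {c, d} \<longrightarrow>
        dist (hex_point a) (hex_point b) \<noteq> dist (hex_point c) (hex_point d) \<or>
        line_slope (hex_point a) (hex_point b) \<noteq> line_slope (hex_point c) (hex_point d))"

definition hex_DD :: "nat \<Rightarrow> nat \<Rightarrow> (int \<times> int) set \<Rightarrow> bool" where
  "hex_DD m r A \<longleftrightarrow>
     finite A \<and> card A = m \<and> (\<forall>a\<in>A. \<forall>b\<in>A. hex_dist a b \<le> r) \<and> distinct_lines A"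

lemma hex_adj_iff_dist:
  "(p, q) \<in> hex_adj \<longleftrightarrow> dist (hex_point p) (hex_point q) = 1"
proof -
  define x where "x = fst q - fst p"
  define y where "y = snd q - snd p"
  have d: "dist (hex_point p) (hex_point q) = sqrt (real_of_int (x\<^sup>2 - x * y + y\<^sup>2))"
  proof -
    have "fst (hex_point p) - fst (hex_point q) = - (real_of_int x - real_of_int y / 2)"
      "snd (hex_point p) - snd (hex_point q) = - (sqrt 3 / 2 * real_of_int y)"
      unfolding hex_point_def x_def y_def by (simp_all add: algebra_simps diff_divide_distrib)
    then have "(dist (fst (hex_point p)) (fst (hex_point q)))\<^sup>2 = (real_of_int x - real_of_int y / 2)\<^sup>2"
      "(dist (snd (hex_point p)) (snd (hex_point q)))\<^sup>2 = 3 / 4 * (real_of_int y)\<^sup>2"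
      by (simp_all only: dist_real_def power2_abs power2_minus)
         (simp add: power_mult_distrib power_divide)
    then show ?thesis
      unfolding dist_prod_def by (simp add: power2_diff power_divide)
  qed
  have "dist (hex_point p) (hex_point q) = 1 \<longleftrightarrow> x\<^sup>2 - x * y + y\<^sup>2 = 1"
    unfolding d by (simp only: real_sqrt_eq_1_iff of_int_eq_1_iff)
  also have "\<dots> \<longleftrightarrow> (x, y) \<in> {(1,0), (-1,0), (0,1), (0,-1), (1,1), (-1,-1)}" (is "?L \<longleftrightarrow> ?R")
  proof
    assume ?L
    then have e: "(2 * x - y)\<^sup>2 + 3 * y\<^sup>2 = 4" "(2 * y - x)\<^sup>2 + 3 * x\<^sup>2 = 4"
      by (simp_all add: power2_eq_square algebra_simps)
    have "3 * y\<^sup>2 \<le> 4" "3 * x\<^sup>2 \<le> 4"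
      using e zero_le_power2[of "2 * x - y"] zero_le_power2[of "2 * y - x"] by linarith+
    then have "y\<^sup>2 < 2\<^sup>2" "x\<^sup>2 < 2\<^sup>2" by simp_all
    then have "\<bar>y\<bar> < 2" "\<bar>x\<bar> < 2"
      using power2_less_imp_less[of "\<bar>y\<bar>" 2] power2_less_imp_less[of "\<bar>x\<bar>" 2] by simp_all
    then have "x = -1 \<or> x = 0 \<or> x = 1" "y = -1 \<or> y = 0 \<or> y = 1" by auto
    with \<open>?L\<close> show ?R by (auto simp: power2_eq_square)
  next
    assume ?R then show ?L by auto
  qed
  also have "\<dots> \<longleftrightarrow> (p, q) \<in> hex_adj"
  proof -
    have "p = (fst p, snd p)" "q = (fst p + x, snd p + y)" unfolding x_def y_def by simp_all
    then obtain i j where pq: "p = (i, j)" "q = (i + x, j + y)" by metis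
    show ?thesis unfolding pq hex_adj_def by simp
  qed
  finally show ?thesis by simp
qed

lemma hex_adj_pow_bound:
  "(p, q) \<in> hex_adj ^^ n \<Longrightarrow>
     \<bar>fst p - fst q\<bar> \<le> int n \<and> \<bar>snd p - snd q\<bar> \<le> int n \<and>
     \<bar>(fst p - fst q) - (snd p - snd q)\<bar> \<le> int n"
proof (induction n arbitrary: q)
  case 0 then show ?case by simp
next
  case (Suc n)
  then obtain z where z: "(p, z) \<in> hex_adj ^^ n" "(z, q) \<in> hex_adj" by auto
  from Suc.IH[OF z(1)] z(2) show ?case unfolding hex_adj_def by auto
qed

lemma hex_adj_pow_exists:
  "max (abs (fst p - fst q)) (max (abs (snd p - snd q)) (abs ((fst p - fst q) - (snd p - snd q)))) = int n \<Longrightarrow>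
     (p, q) \<in> hex_adj ^^ n"
proof (induction n arbitrary: q)
  case 0 then show ?case by (auto simp: prod_eq_iff)
next
  case (Suc n)
  define x where "x = fst q - fst p"
  define y where "y = snd q - snd p"
  define u :: int where "u = sgn x"
  define v :: int where "v = (if x > 0 \<and> y > 0 \<or> x < 0 \<and> y < 0 \<or> x = 0 then sgn y else 0)"
  define z where "z = (fst q - u, snd q - v)"
  have m: "max (abs x) (max (abs y) (abs (x - y))) = int n + 1"
  proof -
    have "fst p - fst q = - x" "snd p - snd q = - y" unfolding x_def y_def by simp_all
    moreover have "- x - - y = - (x - y)" by simp
    ultimately show ?thesis using Suc.prems by (simp only: abs_minus_cancel of_nat_Suc add.commute)
  qed
  have "max (abs (fst p - fst z)) (max (abs (snd p - snd z)) (abs ((fst p - fst z) - (snd p - snd z))))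
      = max (abs (x - u)) (max (abs (y - v)) (abs ((x - u) - (y - v))))"
  proof -
    have "fst p - fst z = - (x - u)" "snd p - snd z = - (y - v)"
      unfolding z_def x_def y_def by simp_all
    moreover have "- (x - u) - - (y - v) = - ((x - u) - (y - v))" by simp
    ultimately show ?thesis by (simp only: abs_minus_cancel)
  qed
  also have "\<dots> = int n"
  proof -
    consider "x > 0" "y > 0" | "x > 0" "y \<le> 0" | "x < 0" "y < 0" | "x < 0" "y \<ge> 0"
      | "x = 0" "y > 0" | "x = 0" "y < 0"
      using m by (cases x "0::int" rule: linorder_cases; cases y "0::int" rule: linorder_cases) simp_all
    then show ?thesis
    proof cases
      case 1
      then have "u = 1" "v = 1" by (simp_all add: u_def v_def)
      with 1 have "abs (x - u) = x - 1" "abs (y - v) = y - 1" "abs ((x - u) - (y - v)) = abs (x - y)"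
        "abs x = x" "abs y = y" by simp_all
      with 1 m show ?thesis by (simp add: max_def split: if_splits)
    next
      case 2
      then have "u = 1" "v = 0" by (simp_all add: u_def v_def)
      with 2 have "abs (x - u) = x - 1" "abs (y - v) = - y" "abs ((x - u) - (y - v)) = x - 1 - y"
        "abs x = x" "abs y = -y" "abs (x - y) = x - y" by simp_all
      with 2 m show ?thesis by (simp add: max_def split: if_splits)
    next
      case 3
      then have "u = -1" "v = -1" by (simp_all add: u_def v_def)
      with 3 have "abs (x - u) = - x - 1" "abs (y - v) = - y - 1" "abs ((x - u) - (y - v)) = abs (x - y)"
        "abs x = -x" "abs y = -y" by simp_all
      with 3 m show ?thesis by (simp add: max_def split: if_splits)
    next
      case 4
      then have "u = -1" "v = 0" by (simp_all add: u_def v_def)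
      with 4 have "abs (x - u) = - x - 1" "abs (y - v) = y" "abs ((x - u) - (y - v)) = y - x - 1"
        "abs x = -x" "abs y = y" "abs (x - y) = y - x" by simp_all
      with 4 m show ?thesis by (simp add: max_def split: if_splits)
    next
      case 5
      then have "u = 0" "v = 1" by (simp_all add: u_def v_def)
      with 5 have "abs (x - u) = 0" "abs (y - v) = y - 1" "abs ((x - u) - (y - v)) = y - 1"
        "abs x = 0" "abs y = y" "abs (x - y) = y" by simp_all
      with 5 m show ?thesis by (simp add: max_def split: if_splits)
    next
      case 6
      then have "u = 0" "v = -1" by (simp_all add: u_def v_def)
      with 6 have "abs (x - u) = 0" "abs (y - v) = - y - 1" "abs ((x - u) - (y - v)) = - y - 1"
        "abs x = 0" "abs y = -y" "abs (x - y) = -y" by simp_all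
      with 6 m show ?thesis by (simp add: max_def split: if_splits)
    qed
  qed
  finally have "(p, z) \<in> hex_adj ^^ n" by (rule Suc.IH)
  moreover have "(z, q) \<in> hex_adj"
  proof -
    have "(u, v) \<in> {(1,0), (-1,0), (0,1), (0,-1), (1,1), (-1,-1)}"
    proof -
      have "\<not> (x = 0 \<and> y = 0)" using m by auto
      then show ?thesis unfolding u_def v_def by (auto simp: sgn_if)
    qed
    then show ?thesis unfolding hex_adj_def z_def by (cases q) auto
  qed
  ultimately show ?case by auto
qed

lemma hex_dist_eq_max:
  "int (hex_dist p q) =
     max (abs (fst p - fst q)) (max (abs (snd p - snd q)) (abs ((fst p - fst q) - (snd p - snd q))))"
    (is "_ = ?m")
proof -
  have m0: "0 \<le> ?m" by (rule max.coboundedI1) (rule abs_ge_zero)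
  have "hex_dist p q = nat ?m"
    unfolding hex_dist_def
  proof (rule Least_equality)
    show "(p, q) \<in> hex_adj ^^ nat ?m" by (rule hex_adj_pow_exists, subst nat_0_le[OF m0]) (rule refl)
  next
    fix n assume "(p, q) \<in> hex_adj ^^ n"
    from hex_adj_pow_bound[OF this] show "nat ?m \<le> n" by auto
  qed
  then show ?thesis using nat_0_le[OF m0] by (simp only:)
qed

lemma same_length_slope_iff:
  fixes x y z w :: "real \<times> real"
  assumes "x \<noteq> y" "z \<noteq> w"
  shows "dist x y = dist z w \<and> line_slope x y = line_slope z w \<longleftrightarrow> x - y = z - w \<or> x - y = w - z"
    (is "?L \<longleftrightarrow> ?R")
proof -
  define a where "a = fst y - fst x"
  define b where "b = snd y - snd x"
  define c where "c = fst w - fst z"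
  define d where "d = snd w - snd z"
  have D: "dist x y = sqrt (a\<^sup>2 + b\<^sup>2)" "dist z w = sqrt (c\<^sup>2 + d\<^sup>2)"
    unfolding dist_prod_def dist_real_def a_def b_def c_def d_def
    by (simp_all add: power2_commute)
  have S: "line_slope x y = (if a = 0 then None else Some (b / a))"
          "line_slope z w = (if c = 0 then None else Some (d / c))"
    unfolding line_slope_def a_def b_def c_def d_def by auto
  have R: "?R \<longleftrightarrow> (a = c \<and> b = d) \<or> (a = - c \<and> b = - d)"
    unfolding a_def b_def c_def d_def by (auto simp: prod_eq_iff)
  have "?L \<longleftrightarrow> (a = c \<and> b = d) \<or> (a = - c \<and> b = - d)"
  proof
    assume L: ?L
    then have e: "a\<^sup>2 + b\<^sup>2 = c\<^sup>2 + d\<^sup>2" using D by simp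
    show "(a = c \<and> b = d) \<or> (a = - c \<and> b = - d)"
    proof (cases "a = 0")
      case True
      then have "c = 0" using L S by (auto split: if_splits)
      with True e show ?thesis by (auto simp: power2_eq_iff)
    next
      case False
      then have c: "c \<noteq> 0" and s: "b / a = d / c" using L S by (auto split: if_splits)
      define k where "k = b / a"
      have b: "b = k * a" unfolding k_def using False by simp
      have d: "d = k * c" unfolding k_def s using c by simp
      have "(1 + k\<^sup>2) * a\<^sup>2 = (1 + k\<^sup>2) * c\<^sup>2"
        using e unfolding b d by (simp add: algebra_simps power_mult_distrib)
      moreover have "1 + k\<^sup>2 \<noteq> 0" using zero_le_power2[of k] by linarith
      ultimately have "a\<^sup>2 = c\<^sup>2" by simp
      then show ?thesis using b d by (auto simp: power2_eq_iff)
    qed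
  next
    assume "(a = c \<and> b = d) \<or> (a = - c \<and> b = - d)"
    then show ?L using D S by auto
  qed
  with R show ?thesis by simp
qed

lemma hex_point_diff: "hex_point a - hex_point b = hex_point (a - b)"
  by (simp add: hex_point_def prod_eq_iff algebra_simps diff_divide_distrib)

lemma hex_point_eq_iff: "hex_point a = hex_point b \<longleftrightarrow> a = b"
  by (auto simp: hex_point_def prod_eq_iff)

lemma distinct_lines_iff_differences:
  "distinct_lines A \<longleftrightarrow>
     (\<forall>a\<in>A. \<forall>b\<in>A. \<forall>c\<in>A. \<forall>d\<in>A. a \<noteq> b \<longrightarrow> c \<noteq> d \<longrightarrow>
        a - b = c - d \<longrightarrow> a = c \<and> b = d)"
proof -
  have key: "(dist (hex_point a) (hex_point b) \<noteq> dist (hex_point c) (hex_point d) \<or>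
        line_slope (hex_point a) (hex_point b) \<noteq> line_slope (hex_point c) (hex_point d)) \<longleftrightarrow>
        a - b \<noteq> c - d \<and> a - b \<noteq> d - c" if "a \<noteq> b" "c \<noteq> d" for a b c d
    using same_length_slope_iff[of "hex_point a" "hex_point b" "hex_point c" "hex_point d"] that
    by (auto simp: hex_point_diff hex_point_eq_iff)
  have "distinct_lines A \<longleftrightarrow>
     (\<forall>a\<in>A. \<forall>b\<in>A. \<forall>c\<in>A. \<forall>d\<in>A. a \<noteq> b \<longrightarrow> c \<noteq> d \<longrightarrow> {a, b} \<noteq> {c, d} \<longrightarrow>
        a - b \<noteq> c - d \<and> a - b \<noteq> d - c)"
    unfolding distinct_lines_def by (intro ball_cong refl imp_cong key)
  also have "\<dots> \<longleftrightarrow> (\<forall>a\<in>A. \<forall>b\<in>A. \<forall>c\<in>A. \<forall>d\<in>A. a \<noteq> b \<longrightarrow> c \<noteq> d \<longrightarrow>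
        a - b = c - d \<longrightarrow> a = c \<and> b = d)" (is "?P \<longleftrightarrow> ?Q")
  proof
    assume P: ?P
    show ?Q
    proof (intro ballI impI)
      fix a b c d assume h: "a \<in> A" "b \<in> A" "c \<in> A" "d \<in> A" "a \<noteq> b" "c \<noteq> d" "a - b = c - d"
      then have "{a, b} = {c, d}" using P by blast
      then have "(a = c \<and> b = d) \<or> (a = d \<and> b = c)" by (auto simp: doubleton_eq_iff)
      moreover have "\<not> (a = d \<and> b = c)" using h by (auto simp: prod_eq_iff)
      ultimately show "a = c \<and> b = d" by blast
    qed
  next
    assume Q: ?Q
    show ?P
    proof (intro ballI impI)
      fix a b c d assume h: "a \<in> A" "b \<in> A" "c \<in> A" "d \<in> A" "a \<noteq> b" "c \<noteq> d" "{a, b} \<noteq> {c, d}"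
      show "a - b \<noteq> c - d \<and> a - b \<noteq> d - c"
      proof (intro conjI notI)
        assume "a - b = c - d"
        with Q h(1-6) have "a = c \<and> b = d" by blast
        with h(7) show False by simp
      next
        assume "a - b = d - c"
        with Q h(1,2,4,3,5) h(6)[symmetric] have "a = d \<and> b = c" by blast
        with h(7) show False by (simp add: insert_commute)
      qed
    qed
  qed
  finally show ?thesis .
qed

end

theory Submission
  imports Defs
begin

text \<open>
  Let \<open>W\<close> be a hexagonal ball of radius \<open>\<rho>\<close> and let \<open>T\<close> be the set of translations moving \<open>W\<close> onto
  some dot. Counting pairs of dots in the translates of \<open>W\<close>, every non-zero difference of
  elements of \<open>W\<close> is realised by at most one pair of dots, so the Cauchy--Schwarz inequality gives
  \<open>m\<^sup>2 |W| \<le> |T| (m + |W|)\<close>. Now \<open>|W| \<ge> 3 \<rho>\<^sup>2\<close>, and \<open>T\<close> has hexagonal diameter at most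
  \<open>D = r + 2 \<rho>\<close>, whence \<open>|T| \<le> 3/4 D\<^sup>2 + O(D)\<close>. This yields
  \<open>m \<le> \<surd>3/2 r + \<surd>3 \<rho> + r\<^sup>2 / (8 \<rho>\<^sup>2) + O(r\<^bsup>1/3\<^esup>)\<close>, which is optimised by
  \<open>\<rho>\<^sup>3 \<approx> r\<^sup>2 / (4 \<surd>3)\<close>.
\<close>

section \<open>Counting dots in translates of a window\<close>

text \<open>Two dots in one translate of \<open>W\<close> differ by a difference of two window
  elements, so the second moment of the dot counts is at most \<open>|W| (|A| + |W|)\<close>.
  Cauchy-Schwarz compares this with the first moment \<open>|A| |W|\<close>.\<close>

lemma distinct_differences_window_bound:
  fixes A W T :: "'a::ab_group_add set"
  assumes fin: "finite A" "finite W" "finite T" and "W \<noteq> {}"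
    and T: "\<And>a w. a \<in> A \<Longrightarrow> w \<in> W \<Longrightarrow> a - w \<in> T"
    and dd: "\<And>a b c d. \<lbrakk>a \<in> A; b \<in> A; c \<in> A; d \<in> A; a \<noteq> b; c \<noteq> d; a - b = c - d\<rbrakk> \<Longrightarrow> a = c \<and> b = d"
  shows "(real (card A))\<^sup>2 * card W \<le> card T * (real (card A) + card W)"
proof -
  \<comment> \<open>\<open>P t\<close> encodes the dots in the translate \<open>t + W\<close>, each
    with its position in the window; \<open>Q\<close> collects ordered pairs of dots sharing a
    translate.\<close>
  define P where "P t = {x \<in> A \<times> W. fst x - snd x = t}" for t
  define Q where "Q = (SIGMA t:T. P t \<times> P t)"
  have finP: "finite (P t)" for t
    unfolding P_def using fin by simp
  have "card (A \<times> W) = card (\<Union>t\<in>T. P t)"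
    by (rule arg_cong[where f = card]) (auto simp: P_def T)
  also have "\<dots> = (\<Sum>t\<in>T. card (P t))"
    by (rule card_UN_disjoint) (use fin finP in \<open>auto simp: P_def\<close>)
  finally have sum1: "(\<Sum>t\<in>T. real (card (P t))) = real (card A) * card W"
    by (simp add: card_cartesian_product flip: of_nat_sum of_nat_mult)
  have sum2: "(\<Sum>t\<in>T. (real (card (P t)))\<^sup>2) = card Q"
    unfolding Q_def using fin finP
    by (simp add: card_SigmaI card_cartesian_product power2_eq_square)
  \<comment> \<open>If \<open>a = b\<close>, then \<open>w = v\<close>, and \<open>(a, w)\<close>
    recovers everything. Otherwise \<open>a - b = w - v\<close> is non-zero, so the distinct
    difference property recovers the dots from \<open>(w, v)\<close>.\<close>
  define f where "f = (\<lambda>(t::'a, (a::'a, w::'a), (b::'a, v::'a)). if a = b then Inl (a, w) else Inr (w, v))"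
  have "inj_on f Q"
  proof (rule inj_onI)
    fix x y assume x: "x \<in> Q" and y: "y \<in> Q" and eq: "f x = f y"
    obtain t a w b v where x': "x = (t, (a, w), (b, v))" by (metis prod.exhaust)
    obtain t' a' w' b' v' where y': "y = (t', (a', w'), (b', v'))" by (metis prod.exhaust)
    have hx: "a \<in> A" "b \<in> A" "a - w = t" "b - v = t"
      and hy: "a' \<in> A" "b' \<in> A" "a' - w' = t'" "b' - v' = t'"
      using x y unfolding x' y' Q_def P_def by auto
    show "x = y"
    proof (cases "a = b")
      case True
      then have "a' = b'" "a' = a" "w' = w"
        using eq unfolding x' y' f_def by (auto split: if_splits)
      moreover have "v = w" "v' = w'"
        using True \<open>a' = b'\<close> hx hy by (auto simp: algebra_simps)
      ultimately show ?thesis using True hx hy unfolding x' y' by auto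
    next
      case False
      then have ne: "a' \<noteq> b'" and w: "w' = w" "v' = v"
        using eq unfolding x' y' f_def by (auto split: if_splits)
      have "a - b = w - v" using hx by (metis add_diff_cancel_left diff_add_cancel add.commute)
      moreover have "a' - b' = w' - v'" using hy by (metis add_diff_cancel_left diff_add_cancel add.commute)
      ultimately have "a = a' \<and> b = b'" using dd[of a b a' b'] hx hy False ne w by auto
      then show ?thesis using w hx hy unfolding x' y' by auto
    qed
  qed
  moreover have "f ` Q \<subseteq> (A \<times> W) <+> (W \<times> W)"
    by (auto simp: f_def Q_def P_def)
  ultimately have "card Q \<le> card ((A \<times> W) <+> (W \<times> W))"
    by (rule card_inj_on_le) (use fin in auto)
  then have "card Q \<le> card A * card W + card W * card W"
    using fin by (simp add: card_Plus card_cartesian_product)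
  then have "real (card Q) \<le> real (card A * card W + card W * card W)"
    by (rule of_nat_mono)
  moreover have "(\<Sum>t\<in>T. real (card (P t)))\<^sup>2 \<le> (\<Sum>t\<in>T. (real (card (P t)))\<^sup>2) * card T"
    using Cauchy_Schwarz_ineq_sum[of "\<lambda>t. real (card (P t))" "\<lambda>_. 1" T] by simp
  ultimately have "(real (card A) * card W)\<^sup>2 \<le> real (card A * card W + card W * card W) * card T"
    unfolding sum1 sum2 by (meson mult_right_mono of_nat_0_le_iff order_trans)
  then have "card W * ((real (card A))\<^sup>2 * card W) \<le> card W * (card T * (real (card A) + card W))"
    by (simp add: power2_eq_square algebra_simps)
  moreover have "card W > 0" using assms by (simp add: card_gt_0_iff)
  ultimately show ?thesis by simp
qed

section \<open>Size of a set of bounded hexagonal diameter\<close>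

lemma hex_dist_le_iff:
  "hex_dist p q \<le> n \<longleftrightarrow> \<bar>fst p - fst q\<bar> \<le> int n \<and> \<bar>snd p - snd q\<bar> \<le> int n \<and>
     \<bar>(fst p - fst q) - (snd p - snd q)\<bar> \<le> int n"
proof -
  have "hex_dist p q \<le> n \<longleftrightarrow> int (hex_dist p q) \<le> int n" by simp
  then show ?thesis unfolding hex_dist_eq_max by simp
qed

lemma sum_abs_diff_double_ge: "int D ^ 2 \<le> 2 * (\<Sum>i\<le>D. \<bar>int D - 2 * int i\<bar>)"
proof (induction D rule: induct_nat_012)
  case (ge2 n)
  \<comment> \<open>Peel off both end terms, each equal to \<open>n + 2\<close>; shifting the index
    by one turns the remaining terms into those for \<open>n\<close>.\<close>
  have "(\<Sum>i\<le>Suc (Suc n). \<bar>int (Suc (Suc n)) - 2 * int i\<bar>)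
      = (\<Sum>i\<le>n. \<bar>int n - 2 * int i\<bar>) + 2 * (int n + 2)"
    by (subst sum.atMost_Suc, subst sum.atMost_Suc_shift) simp
  with ge2 show ?case by (simp add: power2_eq_square algebra_simps)
qed simp_all

text \<open>Pairing \<open>i\<close> with \<open>D - i\<close>, the triangle inequality shows that
  no centre \<open>c\<close> does better than the midpoint \<open>D / 2\<close>.\<close>

lemma sum_abs_diff_ge: "int D ^ 2 \<le> 4 * (\<Sum>i\<le>D. \<bar>int i - c\<bar>)"
proof -
  have "(\<Sum>i\<le>D. \<bar>int D - 2 * int i\<bar>) \<le> (\<Sum>i\<le>D. \<bar>int i - c\<bar> + \<bar>int (D - i) - c\<bar>)"
    by (rule sum_mono) auto
  also have "\<dots> = 2 * (\<Sum>i\<le>D. \<bar>int i - c\<bar>)"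
    using sum.nat_diff_reindex[of "\<lambda>i. \<bar>int i - c\<bar>" "Suc D"]
    by (simp add: sum.distrib lessThan_Suc_atMost)
  finally show ?thesis using sum_abs_diff_double_ge[of D] by simp
qed

text \<open>Each of \<open>x\<close>, \<open>y\<close> and \<open>x - y\<close> varies by at most
  \<open>D\<close> on \<open>S\<close>. The strips for \<open>x\<close> and \<open>y\<close> alone
  allow \<open>(D + 1)^2\<close> points; the third strip shortens the columns, removing at least
  \<open>D^2 / 4\<close>.\<close>

lemma card_hex_anticode_le:
  assumes "finite S" and D: "\<And>p q. p \<in> S \<Longrightarrow> q \<in> S \<Longrightarrow> hex_dist p q \<le> D"
  shows "real (card S) \<le> 3 / 4 * (real D)\<^sup>2 + 2 * real D + 1"
proof (cases "S = {}")
  case False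
  define x0 where "x0 = Min (fst ` S)"
  define y0 where "y0 = Min (snd ` S)"
  define z0 where "z0 = Min ((\<lambda>p. fst p - snd p) ` S)"
  \<comment> \<open>In column \<open>c\<close> the two ranges for \<open>y\<close> coincide;
    \<open>|i - c|\<close> columns away they are offset by that amount. Clamping to
    \<open>[0, D]\<close> brings the centre no farther from any column and keeps the column bound
    positive even where the ranges are disjoint.\<close>
  define c where "c = z0 + D + y0 - x0"
  define c' where "c' = max 0 (min (int D) c)"
  have range: "Min (\<phi> ` S) \<le> \<phi> p \<and> \<phi> p \<le> Min (\<phi> ` S) + D"
    if "p \<in> S" and le: "\<And>q. q \<in> S \<Longrightarrow> \<bar>\<phi> p - \<phi> q\<bar> \<le> int D" for \<phi> :: "int \<times> int \<Rightarrow> int" and p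
  proof -
    have "Min (\<phi> ` S) \<in> \<phi> ` S" using assms(1) False by (intro Min_in) auto
    then obtain q where "q \<in> S" "Min (\<phi> ` S) = \<phi> q" by auto
    moreover have "Min (\<phi> ` S) \<le> \<phi> p" using assms(1) that(1) by (intro Min_le) auto
    ultimately show ?thesis using le[of q] by auto
  qed
  have fst: "x0 \<le> fst p \<and> fst p \<le> x0 + D" if "p \<in> S" for p
    unfolding x0_def using D[OF that] by (intro range[OF that]) (simp add: hex_dist_le_iff)
  have snd: "y0 \<le> snd p \<and> snd p \<le> y0 + D" if "p \<in> S" for p
    unfolding y0_def using D[OF that] by (intro range[OF that]) (simp add: hex_dist_le_iff)
  have diff: "z0 \<le> fst p - snd p \<and> fst p - snd p \<le> z0 + D" if "p \<in> S" for p
    unfolding z0_def using D[OF that] by (intro range[OF that]) (simp add: hex_dist_le_iff algebra_simps)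
  define Y where "Y i = {max y0 (x0 + int i - z0 - D)..min (y0 + D) (x0 + int i - z0)}" for i
  define R where "R = (SIGMA i:{..D}. Y i)"
  have "S \<subseteq> (\<lambda>(i, y). (x0 + int i, y)) ` R"
  proof
    fix p assume p: "p \<in> S"
    have "(nat (fst p - x0), snd p) \<in> R"
      using fst[OF p] snd[OF p] diff[OF p] unfolding R_def Y_def by auto
    moreover have "p = (\<lambda>(i, y). (x0 + int i, y)) (nat (fst p - x0), snd p)"
      using fst[OF p] by (cases p) auto
    ultimately show "p \<in> (\<lambda>(i, y). (x0 + int i, y)) ` R" by (rule rev_image_eqI)
  qed
  moreover have finR: "finite R" unfolding R_def Y_def by auto
  ultimately have "card S \<le> card R"
    by (rule surj_card_le[rotated])
  also have "card R = (\<Sum>i\<le>D. card (Y i))"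
    unfolding R_def by (rule card_SigmaI) (auto simp: Y_def)
  finally have "int (card S) \<le> (\<Sum>i\<le>D. int (card (Y i)))"
    by (simp flip: of_nat_sum)
  also have "\<dots> \<le> (\<Sum>i\<le>D. int D + 1 - \<bar>int i - c'\<bar>)"
  proof (rule sum_mono)
    fix i assume "i \<in> {..D}"
    then show "int (card (Y i)) \<le> int D + 1 - \<bar>int i - c'\<bar>"
      unfolding Y_def c'_def c_def by auto
  qed
  also have "\<dots> = (int D + 1)\<^sup>2 - (\<Sum>i\<le>D. \<bar>int i - c'\<bar>)"
    by (simp add: sum_subtractf power2_eq_square)
  finally have "4 * int (card S) \<le> 4 * (int D + 1)\<^sup>2 - int D ^ 2"
    using sum_abs_diff_ge[of D c'] by linarith
  then have "real_of_int (4 * int (card S)) \<le> real_of_int (4 * (int D + 1)\<^sup>2 - int D ^ 2)"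
    by (rule of_int_le_iff[THEN iffD2])
  then show ?thesis by (simp add: power2_eq_square algebra_simps)
qed simp

section \<open>Hexagonal balls as windows\<close>

lemma finite_hex_ball: "finite {p. hex_dist p 0 \<le> n}"
proof (rule finite_subset)
  show "{p. hex_dist p 0 \<le> n} \<subseteq> {- int n..int n} \<times> {- int n..int n}"
    by (auto simp: hex_dist_le_iff)
qed simp

text \<open>The ball contains three disjoint rhombi with \<open>n\<^sup>2\<close> points each.\<close>

lemma card_hex_ball_ge: "3 * n\<^sup>2 \<le> card {p. hex_dist p 0 \<le> n}"
proof -
  define X where "X = {1..int n} \<times> {1..int n}"
  define f where "f = (\<lambda>(i::int, j::int). (i, j))"
  define g where "g = (\<lambda>(i::int, j::int). (- j, i - 1 - j))"
  define h where "h = (\<lambda>(i::int, j::int). (i - j, - j))"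
  have cX: "card X = n\<^sup>2" "finite X"
    unfolding X_def by (simp_all add: card_cartesian_product power2_eq_square)
  have inj: "inj_on f X" "inj_on g X" "inj_on h X"
    unfolding f_def g_def h_def inj_on_def by auto
  \<comment> \<open>The images lie in the disjoint sectors \<open>x, y > 0\<close>;
    \<open>x < 0, x \<le> y\<close>; and \<open>y < 0, y < x\<close>.\<close>
  have "card (f ` X \<union> g ` X \<union> h ` X) = card (f ` X) + card (g ` X) + card (h ` X)"
    by (subst card_Un_disjoint; (subst card_Un_disjoint)?)
       (use cX in \<open>auto simp: f_def g_def h_def X_def\<close>)
  also have "\<dots> = 3 * n\<^sup>2"
    using inj cX by (simp add: card_image)
  finally have "3 * n\<^sup>2 = card (f ` X \<union> g ` X \<union> h ` X)" by simp
  also have "\<dots> \<le> card {p. hex_dist p 0 \<le> n}"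
    by (rule card_mono[OF finite_hex_ball])
       (auto simp: f_def g_def h_def X_def hex_dist_le_iff)
  finally show ?thesis .
qed

text \<open>Here \<open>a\<close> is the size of the ball of radius \<open>\<rho>\<close>, and the
  first factor on the right bounds the number of translates, which form a set of diameter at most
  \<open>r + 2 \<rho>\<close>.\<close>

lemma hex_DD_window_bound:
  assumes "hex_DD m r A" "\<rho> > 0"
  obtains a :: real where "a \<ge> 3 * (real \<rho>)\<^sup>2"
    "(real m)\<^sup>2 * a \<le> (3 / 4 * (real r + 2 * real \<rho>)\<^sup>2 + 2 * (real r + 2 * real \<rho>) + 1) * (m + a)"
proof
  define W where "W = {p. hex_dist p 0 \<le> \<rho>}"
  define T where "T = (\<Union>a\<in>A. (\<lambda>w. a - w) ` W)"
  have A: "finite A" "card A = m" "\<And>a b. a \<in> A \<Longrightarrow> b \<in> A \<Longrightarrow> hex_dist a b \<le> r"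
    and "distinct_lines A"
    using assms(1) unfolding hex_DD_def by simp_all
  then have dd: "\<And>a b c d. \<lbrakk>a \<in> A; b \<in> A; c \<in> A; d \<in> A; a \<noteq> b; c \<noteq> d; a - b = c - d\<rbrakk> \<Longrightarrow> a = c \<and> b = d"
    unfolding distinct_lines_iff_differences by meson
  have W: "finite W" "3 * \<rho>\<^sup>2 \<le> card W"
    unfolding W_def by (rule finite_hex_ball, rule card_hex_ball_ge)
  then have "W \<noteq> {}" using assms(2) by auto
  have "real (3 * \<rho>\<^sup>2) \<le> real (card W)" using W(2) by (rule of_nat_mono)
  then show "real (card W) \<ge> 3 * (real \<rho>)\<^sup>2" by simp
  have T: "finite T" unfolding T_def using A W by auto
  have "hex_dist p q \<le> r + 2 * \<rho>" if pqT: "p \<in> T" "q \<in> T" for p q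
  proof -
    obtain a w b v where pq: "p = a - w" "q = b - v" "a \<in> A" "b \<in> A" "w \<in> W" "v \<in> W"
      using pqT unfolding T_def by blast
    have ab: "hex_dist a b \<le> r" and w: "hex_dist w 0 \<le> \<rho>" and v: "hex_dist v 0 \<le> \<rho>"
      using pq A unfolding W_def by auto
    \<comment> \<open>The hexagonal norm is a maximum of three absolute values of linear forms, so
      the triangle inequality is applied to each form.\<close>
    have tri: "\<bar>u - x + y\<bar> \<le> int (r + 2 * \<rho>)"
      if "\<bar>u\<bar> \<le> int r" "\<bar>x\<bar> \<le> int \<rho>" "\<bar>y\<bar> \<le> int \<rho>" for u x y
      using that by linarith
    have "fst p - fst q = (fst a - fst b) - fst w + fst v"
      "snd p - snd q = (snd a - snd b) - snd w + snd v"
      "(fst p - fst q) - (snd p - snd q)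
        = ((fst a - fst b) - (snd a - snd b)) - (fst w - snd w) + (fst v - snd v)"
      unfolding pq by simp_all
    then show ?thesis
      using ab w v unfolding hex_dist_le_iff by (simp only: tri fst_zero snd_zero diff_zero simp_thms)
  qed
  from card_hex_anticode_le[OF T this]
  have cT: "real (card T) \<le> 3 / 4 * (real r + 2 * real \<rho>)\<^sup>2 + 2 * (real r + 2 * real \<rho>) + 1"
    by simp
  have "(real m)\<^sup>2 * card W \<le> card T * (real m + card W)"
    unfolding A(2)[symmetric]
    by (rule distinct_differences_window_bound[OF A(1) W(1) T \<open>W \<noteq> {}\<close> _ dd]) (unfold T_def, blast)
  also have "\<dots> \<le> (3 / 4 * (real r + 2 * real \<rho>)\<^sup>2 + 2 * (real r + 2 * real \<rho>) + 1) * (real m + card W)"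
    by (rule mult_right_mono[OF cT]) simp
  finally show "(real m)\<^sup>2 * card W \<le>
    (3 / 4 * (real r + 2 * real \<rho>)\<^sup>2 + 2 * (real r + 2 * real \<rho>) + 1) * (real m + card W)" .
qed

section \<open>Solving and optimising the inequality\<close>

text \<open>Completing the square gives \<open>m \<le> b / 2 + sqrt (s^2 + b^2 / 4)\<close> with
  \<open>b = s^2 / a\<close>, and the root is at most \<open>s + b^2 / (8 s)\<close>.\<close>

lemma quadratic_root_bound:
  fixes m s a :: real
  assumes "s > 0" "a > 0" "m\<^sup>2 * a \<le> s\<^sup>2 * (m + a)"
  shows "m \<le> s + s\<^sup>2 / (2 * a) + s ^ 3 / (8 * a\<^sup>2)"
proof -
  define b where "b = s\<^sup>2 / a"
  have "m\<^sup>2 \<le> s\<^sup>2 + b * m"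
    using assms unfolding b_def by (simp add: field_simps)
  then have "(m - b / 2)\<^sup>2 \<le> s\<^sup>2 + b\<^sup>2 / 4"
    by (simp add: power2_eq_square algebra_simps)
  also have "\<dots> \<le> (s + b\<^sup>2 / (8 * s))\<^sup>2"
    using assms by (simp add: power2_sum)
  finally have "m - b / 2 \<le> s + b\<^sup>2 / (8 * s)"
    by (rule power2_le_imp_le) (use assms in simp)
  moreover have "b\<^sup>2 / (8 * s) = s ^ 3 / (8 * a\<^sup>2)"
    unfolding b_def using assms by (simp add: field_simps power2_eq_square power3_eq_cube)
  ultimately show ?thesis unfolding b_def by simp
qed

text \<open>With \<open>q\<close> the cube root of \<open>r\<close> and \<open>\<rho>\<close> about
  \<open>\<alpha> q^2\<close>, the three terms of the root bound have orders \<open>q^3\<close>,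
  \<open>q^2\<close> and \<open>q\<close>. The coefficient of \<open>q\<close> depends on
  \<open>\<alpha>\<close> only.\<close>

lemma window_estimate:
  fixes \<alpha> q \<rho> a m :: real
  assumes "\<alpha> > 0" "q \<ge> 1" "\<alpha> * q\<^sup>2 \<le> \<rho>" "\<rho> \<le> \<alpha> * q\<^sup>2 + 1" "3 * \<rho>\<^sup>2 \<le> a" "m \<ge> 0"
    and m: "m\<^sup>2 * a \<le> (3 / 4 * (q ^ 3 + 2 * \<rho>)\<^sup>2 + 2 * (q ^ 3 + 2 * \<rho>) + 1) * (m + a)"
  defines "K \<equiv> 2 * \<alpha> + 4"
  shows "m \<le> sqrt 3 / 2 * q ^ 3 + (sqrt 3 * \<alpha> + 1 / (8 * \<alpha>\<^sup>2)) * q\<^sup>2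
    + (2 * sqrt 3 + (2 * K + K\<^sup>2) / (8 * \<alpha>\<^sup>2) + (sqrt 3 / 2 * (1 + K)) ^ 3 / (72 * \<alpha> ^ 4)) * q"
proof -
  define X where "X = q ^ 3 + 2 * \<alpha> * q\<^sup>2"
  \<comment> \<open>The shift 4 absorbs both the rounding of \<open>\<rho>\<close>, which costs 2,
    and the lower-order terms of the anticode bound, leaving a perfect square.\<close>
  define s where "s = sqrt 3 / 2 * (X + 4)"
  have q: "q > 0" "1 \<le> q\<^sup>2" "q \<le> q\<^sup>2" "q\<^sup>2 \<le> q ^ 3" "1 \<le> q ^ 3"
    using assms(2) power_increasing[of 1 2 q] power_increasing[of 2 3 q] by (auto simp: one_le_power)
  have X: "X > 0" unfolding X_def using assms(1) q by (simp add: add_pos_pos)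
  have s: "s > 0" unfolding s_def using X by simp
  have "\<rho> > 0" using assms(1,3) q by (meson less_le_trans mult_pos_pos zero_less_power)
  have a: "3 * \<alpha>\<^sup>2 * q ^ 4 \<le> a"
  proof -
    have "(\<alpha> * q\<^sup>2)\<^sup>2 \<le> \<rho>\<^sup>2" using assms(1,3) q by (intro power_mono) auto
    then show ?thesis using assms(5) by (simp add: power_mult_distrib flip: power_mult)
  qed
  have a0: "a > 0" using a assms(1) q by (smt (verit) mult_pos_pos zero_less_power)
  have le: "q ^ 3 + 2 * \<rho> \<le> X + 2" using assms(4) unfolding X_def by simp
  then have sq_le: "(q ^ 3 + 2 * \<rho>)\<^sup>2 \<le> (X + 2)\<^sup>2"
    by (rule power_mono) (use \<open>\<rho> > 0\<close> q in simp)
  have "3 / 4 * (q ^ 3 + 2 * \<rho>)\<^sup>2 + 2 * (q ^ 3 + 2 * \<rho>) + 1 \<le> 3 / 4 * (X + 2)\<^sup>2 + 2 * (X + 2) + 1"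
    by (rule add_mono[OF add_mono[OF mult_left_mono[OF sq_le] mult_left_mono[OF le]] order_refl]) simp_all
  also have "\<dots> \<le> s\<^sup>2"
    unfolding s_def power_mult_distrib using X by (simp add: power_divide power2_sum)
  finally have "m\<^sup>2 * a \<le> s\<^sup>2 * (m + a)"
    using m a0 assms(6) by (smt (verit) mult_right_mono)
  from quadratic_root_bound[OF s a0 this]
  have main: "m \<le> s + s\<^sup>2 / (2 * a) + s ^ 3 / (8 * a\<^sup>2)" .
  have K: "K > 0" unfolding K_def using assms(1) by simp
  have sq: "s \<le> sqrt 3 / 2 * (q\<^sup>2 * (q + K))"
  proof -
    have "X + 4 \<le> q\<^sup>2 * (q + K)"
      unfolding X_def K_def using q by (simp add: algebra_simps power2_eq_square power3_eq_cube)
    then show ?thesis unfolding s_def by simp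
  qed
  have "s\<^sup>2 / (2 * a) \<le> (sqrt 3 / 2 * (q\<^sup>2 * (q + K)))\<^sup>2 / (2 * (3 * \<alpha>\<^sup>2 * q ^ 4))"
    using sq s a assms(1) q by (intro frac_le power_mono) auto
  also have "(sqrt 3 / 2 * (q\<^sup>2 * (q + K)))\<^sup>2 = 3 / 4 * (q ^ 4 * (q + K)\<^sup>2)"
    unfolding power_mult_distrib by (simp add: power_divide flip: power_mult)
  also have "\<dots> / (2 * (3 * \<alpha>\<^sup>2 * q ^ 4)) = (q + K)\<^sup>2 / (8 * \<alpha>\<^sup>2)"
    using q by simp
  also have "\<dots> \<le> (q\<^sup>2 + (2 * K + K\<^sup>2) * q) / (8 * \<alpha>\<^sup>2)"
  proof (rule divide_right_mono)
    have "K\<^sup>2 * 1 \<le> K\<^sup>2 * q" using assms(2) by (intro mult_left_mono) auto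
    then show "(q + K)\<^sup>2 \<le> q\<^sup>2 + (2 * K + K\<^sup>2) * q" by (simp add: power2_sum algebra_simps)
  qed simp
  finally have t2: "s\<^sup>2 / (2 * a) \<le> (q\<^sup>2 + (2 * K + K\<^sup>2) * q) / (8 * \<alpha>\<^sup>2)" .
  \<comment> \<open>The cubic term is of order \<open>q^9 / q^8 = q\<close>, so a crude bound on
    \<open>s\<close> suffices.\<close>
  have "q\<^sup>2 * (q + K) \<le> q\<^sup>2 * (q * (1 + K))"
    using assms(2) K by (intro mult_left_mono) (auto simp: algebra_simps)
  then have "s \<le> sqrt 3 / 2 * (q\<^sup>2 * (q * (1 + K)))"
    using sq by (smt (verit) mult_left_mono real_sqrt_ge_zero divide_nonneg_nonneg)
  also have "\<dots> = sqrt 3 / 2 * (1 + K) * q ^ 3"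
    by (simp add: power2_eq_square power3_eq_cube)
  finally have "s ^ 3 / (8 * a\<^sup>2) \<le> (sqrt 3 / 2 * (1 + K) * q ^ 3) ^ 3 / (8 * (3 * \<alpha>\<^sup>2 * q ^ 4)\<^sup>2)"
    using s a assms(1) q by (intro frac_le power_mono mult_left_mono) auto
  also have "\<dots> = (sqrt 3 / 2 * (1 + K)) ^ 3 / (72 * \<alpha> ^ 4) * (q ^ 9 / q ^ 8)"
    unfolding power_mult_distrib by (simp flip: power_mult)
  also have "q ^ 9 / q ^ 8 = q"
    using q by (simp add: field_simps flip: power_Suc)
  finally have t3: "s ^ 3 / (8 * a\<^sup>2) \<le> (sqrt 3 / 2 * (1 + K)) ^ 3 / (72 * \<alpha> ^ 4) * q" .
  have "2 * sqrt 3 \<le> 2 * sqrt 3 * q" using assms(2) by simp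
  then have "s \<le> sqrt 3 / 2 * q ^ 3 + sqrt 3 * \<alpha> * q\<^sup>2 + 2 * sqrt 3 * q"
    unfolding s_def X_def by (simp add: algebra_simps)
  with main t2 t3 show ?thesis
    by (simp add: algebra_simps add_divide_distrib)
qed

text \<open>This \<open>\<alpha>\<close> minimises \<open>sqrt 3 x + 1 / (8 x^2)\<close> over
  \<open>x > 0\<close>, as \<open>\<alpha>^3 = 1 / (4 sqrt 3)\<close>. There the first summand is
  twice the second, which supplies the factor 3 turning \<open>3 powr (1/3)\<close> into
  \<open>3 powr (4/3)\<close>.\<close>

lemma optimal_window_constant:
  fixes \<alpha> :: real
  defines "\<alpha> \<equiv> 3 powr (- 1/6) * 2 powr (- 2/3)"
  shows "sqrt 3 * \<alpha> + 1 / (8 * \<alpha>\<^sup>2) = 3 powr (4/3) * 2 powr (-5/3)"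
proof -
  have "sqrt 3 * \<alpha> = (3 powr (1/2) * 3 powr (- 1/6)) * 2 powr (- 2/3)"
    unfolding \<alpha>_def by (simp add: powr_half_sqrt)
  also have "\<dots> = 3 powr (1/3) * 2 powr (- 2/3)"
    by (simp flip: powr_add)
  also have "2 powr (- 2/3 :: real) = 2 powr (1 + - 5/3)" by simp
  also have "\<dots> = 2 * 2 powr (- 5/3 :: real)"
    by (subst powr_add) simp
  finally have 1: "sqrt 3 * \<alpha> = 2 * (3 powr (1/3) * 2 powr (- 5/3))" by simp
  have "\<alpha>\<^sup>2 = 3 powr (- 1/3) * 2 powr (- 4/3)"
    unfolding \<alpha>_def power_mult_distrib by (simp add: power2_eq_square flip: powr_add)
  moreover have "8 * 2 powr (- 4/3) = (2::real) powr (- (- 5/3))"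
  proof -
    have "8 * 2 powr (- 4/3) = (2::real) powr 3 * 2 powr (- 4/3)" by simp
    also have "\<dots> = 2 powr (3 + - 4/3)" by (rule powr_add[symmetric])
    finally show ?thesis by simp
  qed
  ultimately have "8 * \<alpha>\<^sup>2 = 3 powr (- (1/3)) * 2 powr (- (- 5/3))" by simp
  also have "\<dots> = inverse (3 powr (1/3) * 2 powr (- 5/3))"
    by (simp only: powr_minus inverse_mult_distrib)
  finally have "8 * \<alpha>\<^sup>2 = inverse (3 powr (1/3) * 2 powr (- 5/3))" .
  then have 2: "1 / (8 * \<alpha>\<^sup>2) = 3 powr (1/3) * 2 powr (- 5/3)"
    by (metis inverse_eq_divide inverse_inverse_eq)
  have "3 powr (4/3 :: real) = 3 powr (1 + 1/3)" by simp
  also have "\<dots> = 3 * 3 powr (1/3 :: real)" by (subst powr_add) simp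
  finally show ?thesis unfolding 1 2 by simp
qed

theorem theorem7:
  "\<exists>C::real. \<forall>(r::nat) (m::nat). r > 0 \<longrightarrow> (\<exists>A. hex_DD m r A) \<longrightarrow>
     real m \<le> sqrt 3 / 2 * real r + 3 powr (4/3) * 2 powr (-5/3) * real r powr (2/3)
       + C * real r powr (1/3)"
proof -
  define \<alpha> :: real where "\<alpha> = 3 powr (- 1/6) * 2 powr (- 2/3)"
  define K where "K = 2 * \<alpha> + 4"
  define C where "C = 2 * sqrt 3 + (2 * K + K\<^sup>2) / (8 * \<alpha>\<^sup>2) + (sqrt 3 / 2 * (1 + K)) ^ 3 / (72 * \<alpha> ^ 4)"
  have \<alpha>: "\<alpha> > 0" unfolding \<alpha>_def by simp
  have "real m \<le> sqrt 3 / 2 * real r + 3 powr (4/3) * 2 powr (-5/3) * real r powr (2/3)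
       + C * real r powr (1/3)" if r: "r > 0" and A: "hex_DD m r A" for r m A
  proof -
    define q where "q = real r powr (1/3)"
    have q: "q \<ge> 1" unfolding q_def using r by (simp add: ge_one_powr_ge_zero)
    have q2: "q\<^sup>2 = real r powr (2/3)" and q3: "q ^ 3 = real r"
      unfolding q_def using r by (simp_all add: powr_power)
    \<comment> \<open>Rounding up keeps the window at least as large as the optimal real radius and
      changes the radius by at most 1.\<close>
    define \<rho> where "\<rho> = nat \<lceil>\<alpha> * q\<^sup>2\<rceil>"
    have pos: "\<alpha> * q\<^sup>2 > 0" using \<alpha> q by simp
    then have \<rho>: "\<rho> > 0" "\<alpha> * q\<^sup>2 \<le> real \<rho>" "real \<rho> \<le> \<alpha> * q\<^sup>2 + 1"
      unfolding \<rho>_def by (simp_all add: real_nat_ceiling_ge of_nat_ceiling)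
    obtain a :: real where a: "3 * (real \<rho>)\<^sup>2 \<le> a"
      "(real m)\<^sup>2 * a \<le> (3 / 4 * (real r + 2 * real \<rho>)\<^sup>2 + 2 * (real r + 2 * real \<rho>) + 1) * (m + a)"
      using hex_DD_window_bound[OF A \<rho>(1)] .
    have "real m \<le> sqrt 3 / 2 * q ^ 3 + (sqrt 3 * \<alpha> + 1 / (8 * \<alpha>\<^sup>2)) * q\<^sup>2 + C * q"
      unfolding C_def K_def
      by (rule window_estimate[OF \<alpha> q \<rho>(2,3) a(1)]) (use a(2) q3 in simp_all)
    then show ?thesis
      using optimal_window_constant unfolding \<alpha>_def[symmetric] q2 q3 by (simp add: q_def)
  qed
  then show ?thesis by blast
qed

end
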